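(* Let $\mathbb X$ be a category, $T:\mathbb X\to\mathbb X$ a functor, and $p:T\Rightarrow1_{\mathbb X}$, $0:1_{\mathbb X}\Rightarrow T$ natural transformations such that $0$ is a section of $p$. Let $(A\xleftarrow{\alpha}X\xrightarrow{\beta}B,\ \mu)$ be a pregroupoid in $\mathbb X$ and let $e:B\to X$ be an arrow with $\beta e\beta=\beta$. Then the objects $X\,{}_{\beta}\!\times_{\pi^{\alpha}_B}T^{\alpha}_BX$ and $T^{\alpha}X$ are isomorphic.
   Context: Composition of arrows is written in diagrammatic order: $fg$ means first $f$, then $g$ (so $\beta e\beta$ is first $\beta$, then $e$, then $\beta$). That $0$ is a section of $p$ means $0p=1$. All pullbacks mentioned are assumed to exist and to be preserved by $T$. A pregroupoid in $\mathbb X$ is a span $A\xleftarrow{\alpha}X\xrightarrow{\beta}B$ with an arrow $\mu:X\,{}_{\beta}\!\times_{\beta}X\,{}_{\alpha}\!\times_{\alpha}X\to X$, written on generalised elements as $(x,y,z)\mapsto x\circ_yz$ (defined when $\beta(x)=\beta(y)$ and $\alpha(y)=\alpha(z)$), such that: $\alpha(x\circ_yz)=\alpha(x)$; $\beta(x\circ_yz)=\beta(z)$; if $\beta(x)=\beta(y)$ then $x\circ_yy=x$; if $\alpha(x)=\alpha(y)$ then $x\circ_xy=y$; if $\beta(x)=\beta(y)=\beta(z)$ and $\alpha(z)=\alpha(w)$ then $x\circ_y(y\circ_zw)=x\circ_zw$; if $\beta(x)=\beta(y)$ and $\alpha(y)=\alpha(z)=\alpha(w)$ then $(x\circ_yz)\circ_zw=x\circ_yw$.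 $T^{\alpha}X$, with projections $\iota^{\alpha}:T^{\alpha}X\to TX$ and $\pi^{\alpha}:T^{\alpha}X\to A$, is the pullback of $T\alpha:TX\to TA$ along $0:A\to TA$; $p^{\alpha}:=\iota^{\alpha}p:T^{\alpha}X\to X$. $T^{\alpha}_BX$, with projections $\iota_B:T^{\alpha}_BX\to T^{\alpha}X$ and $\pi^{\alpha}_B:T^{\alpha}_BX\to B$, is the pullback of $p^{\alpha}$ along $e:B\to X$. $X\,{}_{\beta}\!\times_{\pi^{\alpha}_B}T^{\alpha}_BX$ is the pullback of $\beta$ and $\pi^{\alpha}_B$ over $B$. *)

theory Defs
  imports Main
begin

record ('o, 'm) precategory =
  Obj :: "'o set"
  Arr :: "'m set"
  Dom :: "'m \<Rightarrow> 'o"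
  Cod :: "'m \<Rightarrow> 'o"
  Ident :: "'o \<Rightarrow> 'm"
  Comp :: "'m \<Rightarrow> 'm \<Rightarrow> 'm"  (infixl ";;\<index>" 70)

text \<open>Composition is in diagrammatic order: \<open>f ;; g\<close> is first \<open>f\<close>, then \<open>g\<close>.\<close>

definition hom :: "('o, 'm, 'z) precategory_scheme \<Rightarrow> 'o \<Rightarrow> 'o \<Rightarrow> 'm set" where
  "hom C X Y = {f \<in> Arr C. Dom C f = X \<and> Cod C f = Y}"

locale category =
  fixes C :: "('o, 'm, 'z) precategory_scheme" (structure)
  assumes Dom_Obj: "f \<in> Arr C \<Longrightarrow> Dom C f \<in> Obj C"
    and Cod_Obj: "f \<in> Arr C \<Longrightarrow> Cod C f \<in> Obj C"
    and Ident_hom: "X \<in> Obj C \<Longrightarrow> Ident C X \<in> hom C X X"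
    and Comp_hom: "f \<in> hom C X Y \<Longrightarrow> g \<in> hom C Y Z \<Longrightarrow> f ;; g \<in> hom C X Z"
    and Ident_Comp: "f \<in> hom C X Y \<Longrightarrow> Ident C X ;; f = f"
    and Comp_Ident: "f \<in> hom C X Y \<Longrightarrow> f ;; Ident C Y = f"
    and Comp_assoc: "f \<in> hom C W X \<Longrightarrow> g \<in> hom C X Y \<Longrightarrow> h \<in> hom C Y Z \<Longrightarrow>
                     (f ;; g) ;; h = f ;; (g ;; h)"

definition isomorphic :: "('o, 'm, 'z) precategory_scheme \<Rightarrow> 'o \<Rightarrow> 'o \<Rightarrow> bool" where
  "isomorphic C X Y \<longleftrightarrow>
     X \<in> Obj C \<and> Y \<in> Obj C \<and>
     (\<exists>f \<in> hom C X Y. \<exists>g \<in> hom C Y X.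
        f ;;\<^bsub>C\<^esub> g = Ident C X \<and> g ;;\<^bsub>C\<^esub> f = Ident C Y)"

record ('o, 'm, 'p, 'n) prefunctor =
  omap :: "'o \<Rightarrow> 'p"
  amap :: "'m \<Rightarrow> 'n"

locale category_functor = C: category C + D: category D
  for C :: "('o, 'm, 'y) precategory_scheme"
    and D :: "('p, 'n, 'z) precategory_scheme" +
  fixes F :: "('o, 'm, 'p, 'n) prefunctor"
  assumes omap_Obj: "X \<in> Obj C \<Longrightarrow> omap F X \<in> Obj D"
    and amap_hom: "f \<in> hom C X Y \<Longrightarrow> amap F f \<in> hom D (omap F X) (omap F Y)"
    and amap_Ident: "X \<in> Obj C \<Longrightarrow> amap F (Ident C X) = Ident D (omap F X)"
    and amap_Comp: "f \<in> hom C X Y \<Longrightarrow> g \<in> hom C Y Z \<Longrightarrow>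
                    amap F (f ;;\<^bsub>C\<^esub> g) = amap F f ;;\<^bsub>D\<^esub> amap F g"

definition id_functor :: "('o, 'm, 'o, 'm) prefunctor" where
  "id_functor = \<lparr>omap = (\<lambda>X. X), amap = (\<lambda>f. f)\<rparr>"

locale natural_transformation = F: category_functor C D F + G: category_functor C D G
  for C :: "('o, 'm, 'y) precategory_scheme"
    and D :: "('p, 'n, 'z) precategory_scheme"
    and F G :: "('o, 'm, 'p, 'n) prefunctor" +
  fixes \<eta> :: "'o \<Rightarrow> 'n"
  assumes component_hom: "X \<in> Obj C \<Longrightarrow> \<eta> X \<in> hom D (omap F X) (omap G X)"
    and naturality: "f \<in> hom C X Y \<Longrightarrow> amap F f ;;\<^bsub>D\<^esub> \<eta> Y = \<eta> X ;;\<^bsub>D\<^esub> amap G f"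

text \<open>\<open>is_pullback C f g P q r\<close>: \<open>P\<close>, with projections \<open>q\<close> to the domain of \<open>f\<close> and \<open>r\<close> to the
  domain of \<open>g\<close>, is a pullback of \<open>f\<close> along \<open>g\<close>.\<close>

definition is_pullback ::
  "('o, 'm, 'z) precategory_scheme \<Rightarrow> 'm \<Rightarrow> 'm \<Rightarrow> 'o \<Rightarrow> 'm \<Rightarrow> 'm \<Rightarrow> bool" where
  "is_pullback C f g P q r \<longleftrightarrow>
     f \<in> Arr C \<and> g \<in> Arr C \<and> Cod C f = Cod C g \<and>
     q \<in> hom C P (Dom C f) \<and> r \<in> hom C P (Dom C g) \<and>
     q ;;\<^bsub>C\<^esub> f = r ;;\<^bsub>C\<^esub> g \<and>
     (\<forall>U x y. x \<in> hom C U (Dom C f) \<longrightarrow> y \<in> hom C U (Dom C g) \<longrightarrow>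
        x ;;\<^bsub>C\<^esub> f = y ;;\<^bsub>C\<^esub> g \<longrightarrow>
        (\<exists>!u. u \<in> hom C U P \<and> u ;;\<^bsub>C\<^esub> q = x \<and> u ;;\<^bsub>C\<^esub> r = y))"

definition preserves_pullback ::
  "('p, 'n, 'z) precategory_scheme \<Rightarrow> ('o, 'm, 'p, 'n) prefunctor \<Rightarrow>
   'm \<Rightarrow> 'm \<Rightarrow> 'o \<Rightarrow> 'm \<Rightarrow> 'm \<Rightarrow> bool" where
  "preserves_pullback D F f g P q r \<longleftrightarrow>
     is_pullback D (amap F f) (amap F g) (omap F P) (amap F q) (amap F r)"

text \<open>The fibre product \<open>X \<^sub>\<beta>\<times>\<^sub>\<beta> X \<^sub>\<alpha>\<times>\<^sub>\<alpha> X\<close>, with its three projections, characterised without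
  choosing a bracketing; lemma \<open>is_triple_pullback_iterated\<close> below compares it with the
  iterated pullback.\<close>

definition is_triple_pullback ::
  "('o, 'm, 'z) precategory_scheme \<Rightarrow> 'm \<Rightarrow> 'm \<Rightarrow> 'o \<Rightarrow> 'm \<Rightarrow> 'm \<Rightarrow> 'm \<Rightarrow> bool" where
  "is_triple_pullback C \<alpha> \<beta> M m1 m2 m3 \<longleftrightarrow>
     \<alpha> \<in> Arr C \<and> \<beta> \<in> Arr C \<and> Dom C \<alpha> = Dom C \<beta> \<and>
     m1 \<in> hom C M (Dom C \<alpha>) \<and> m2 \<in> hom C M (Dom C \<alpha>) \<and> m3 \<in> hom C M (Dom C \<alpha>) \<and>
     m1 ;;\<^bsub>C\<^esub> \<beta> = m2 ;;\<^bsub>C\<^esub> \<beta> \<and> m2 ;;\<^bsub>C\<^esub> \<alpha> = m3 ;;\<^bsub>C\<^esub> \<alpha> \<and>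
     (\<forall>U x y z.
        x \<in> hom C U (Dom C \<alpha>) \<longrightarrow> y \<in> hom C U (Dom C \<alpha>) \<longrightarrow> z \<in> hom C U (Dom C \<alpha>) \<longrightarrow>
        x ;;\<^bsub>C\<^esub> \<beta> = y ;;\<^bsub>C\<^esub> \<beta> \<longrightarrow> y ;;\<^bsub>C\<^esub> \<alpha> = z ;;\<^bsub>C\<^esub> \<alpha> \<longrightarrow>
        (\<exists>!u. u \<in> hom C U M \<and>
              u ;;\<^bsub>C\<^esub> m1 = x \<and> u ;;\<^bsub>C\<^esub> m2 = y \<and> u ;;\<^bsub>C\<^esub> m3 = z))"

definition preserves_triple_pullback ::
  "('p, 'n, 'z) precategory_scheme \<Rightarrow> ('o, 'm, 'p, 'n) prefunctor \<Rightarrow>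
   'm \<Rightarrow> 'm \<Rightarrow> 'o \<Rightarrow> 'm \<Rightarrow> 'm \<Rightarrow> 'm \<Rightarrow> bool" where
  "preserves_triple_pullback D F \<alpha> \<beta> M m1 m2 m3 \<longleftrightarrow>
     is_triple_pullback D (amap F \<alpha>) (amap F \<beta>) (omap F M) (amap F m1) (amap F m2) (amap F m3)"

lemma is_pullback_ex1:
  assumes "is_pullback C f g P q r" "f \<in> hom C Y Z" "g \<in> hom C Y' Z"
    "x \<in> hom C U Y" "y \<in> hom C U Y'" "x ;;\<^bsub>C\<^esub> f = y ;;\<^bsub>C\<^esub> g"
  shows "\<exists>!u. u \<in> hom C U P \<and> u ;;\<^bsub>C\<^esub> q = x \<and> u ;;\<^bsub>C\<^esub> r = y"
proof -
  have "Dom C f = Y" "Dom C g = Y'" using assms(2,3) by (auto simp: hom_def)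
  then show ?thesis using assms(1,4-6) unfolding is_pullback_def by blast
qed

lemma (in category) is_triple_pullback_iterated:
  assumes a: "\<alpha> \<in> hom C X A" and b: "\<beta> \<in> hom C X B"
    and K: "is_pullback C \<beta> \<beta> K k1 k2"
    and M: "is_pullback C (k2 ;; \<alpha>) \<alpha> M q m3"
  shows "is_triple_pullback C \<alpha> \<beta> M (q ;; k1) (q ;; k2) m3"
proof -
  have k: "k1 \<in> hom C K X" "k2 \<in> hom C K X" "k1 ;; \<beta> = k2 ;; \<beta>"
    using K b by (auto simp: is_pullback_def hom_def)
  have k2a: "k2 ;; \<alpha> \<in> hom C K A" by (rule Comp_hom[OF k(2) a])
  have m: "q \<in> hom C M K" "m3 \<in> hom C M X" "q ;; (k2 ;; \<alpha>) = m3 ;; \<alpha>"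
    using M k2a a by (auto simp: is_pullback_def hom_def)
  have cone: "q ;; k1 \<in> hom C M X" "q ;; k2 \<in> hom C M X"
    "(q ;; k1) ;; \<beta> = (q ;; k2) ;; \<beta>" "(q ;; k2) ;; \<alpha> = m3 ;; \<alpha>"
    using Comp_hom[OF m(1) k(1)] Comp_hom[OF m(1) k(2)] Comp_assoc[OF m(1) k(1) b]
      Comp_assoc[OF m(1) k(2) b] Comp_assoc[OF m(1) k(2) a] k(3) m(3) by auto
  have univ: "\<exists>!u. u \<in> hom C U M \<and> u ;; (q ;; k1) = x \<and> u ;; (q ;; k2) = y \<and> u ;; m3 = z"
    if x: "x \<in> hom C U X" and y: "y \<in> hom C U X" and z: "z \<in> hom C U X"
      and xy: "x ;; \<beta> = y ;; \<beta>" and yz: "y ;; \<alpha> = z ;; \<alpha>" for U x y z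
  proof -
    have Kex: "\<exists>!v. v \<in> hom C U K \<and> v ;; k1 = x \<and> v ;; k2 = y"
      by (rule is_pullback_ex1[OF K b b x y xy])
    then obtain v where v: "v \<in> hom C U K" "v ;; k1 = x" "v ;; k2 = y" by blast
    have "v ;; (k2 ;; \<alpha>) = z ;; \<alpha>"
      using Comp_assoc[OF v(1) k(2) a] v(3) yz by simp
    then have Mex: "\<exists>!u. u \<in> hom C U M \<and> u ;; q = v \<and> u ;; m3 = z"
      by (rule is_pullback_ex1[OF M k2a a v(1) z])
    have "u \<in> hom C U M \<and> u ;; (q ;; k1) = x \<and> u ;; (q ;; k2) = y \<and> u ;; m3 = z \<longleftrightarrow>
          u \<in> hom C U M \<and> u ;; q = v \<and> u ;; m3 = z" for u
      using Kex v Comp_assoc[OF _ m(1) k(1)] Comp_assoc[OF _ m(1) k(2)] Comp_hom[OF _ m(1)]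
      by metis
    with Mex show ?thesis by simp
  qed
  have dom: "\<alpha> \<in> Arr C" "\<beta> \<in> Arr C" "Dom C \<alpha> = X" "Dom C \<beta> = X"
    using a b by (auto simp: hom_def)
  show ?thesis
    unfolding is_triple_pullback_def dom(3,4) using dom cone m(2) univ by blast
qed

text \<open>\<open>pregroupoid_op C M m1 m2 m3 \<mu> x y z\<close> is \<open>x \<circ>\<^sub>y z\<close> for generalised elements \<open>x, y, z\<close> of
  \<open>X\<close> with a common domain: the arrow induced into the fibre product, followed by \<open>\<mu>\<close>. It is only
  meaningful when \<open>\<beta>(x) = \<beta>(y)\<close> and \<open>\<alpha>(y) = \<alpha>(z)\<close>.\<close>

definition pregroupoid_op ::
  "('o, 'm, 'z) precategory_scheme \<Rightarrow> 'o \<Rightarrow> 'm \<Rightarrow> 'm \<Rightarrow> 'm \<Rightarrow> 'm \<Rightarrow> 'm \<Rightarrow> 'm \<Rightarrow> 'm \<Rightarrow> 'm" where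
  "pregroupoid_op C M m1 m2 m3 \<mu> x y z =
     (THE u. u \<in> hom C (Dom C x) M \<and>
             u ;;\<^bsub>C\<^esub> m1 = x \<and> u ;;\<^bsub>C\<^esub> m2 = y \<and> u ;;\<^bsub>C\<^esub> m3 = z) ;;\<^bsub>C\<^esub> \<mu>"

locale pregroupoid = category C
  for C :: "('o, 'm, 'z) precategory_scheme" (structure) +
  fixes A X B :: 'o and \<alpha> \<beta> :: 'm
    and M :: 'o and m1 m2 m3 \<mu> :: 'm
  assumes alpha_hom: "\<alpha> \<in> hom C X A"
    and beta_hom: "\<beta> \<in> hom C X B"
    and triple_pullback: "is_triple_pullback C \<alpha> \<beta> M m1 m2 m3"
    and mu_hom: "\<mu> \<in> hom C M X"
    and alpha_op:
      "\<lbrakk>x \<in> hom C U X; y \<in> hom C U X; z \<in> hom C U X; x ;; \<beta> = y ;; \<beta>; y ;; \<alpha> = z ;; \<alpha>\<rbrakk> \<Longrightarrow>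
       pregroupoid_op C M m1 m2 m3 \<mu> x y z ;; \<alpha> = x ;; \<alpha>"
    and beta_op:
      "\<lbrakk>x \<in> hom C U X; y \<in> hom C U X; z \<in> hom C U X; x ;; \<beta> = y ;; \<beta>; y ;; \<alpha> = z ;; \<alpha>\<rbrakk> \<Longrightarrow>
       pregroupoid_op C M m1 m2 m3 \<mu> x y z ;; \<beta> = z ;; \<beta>"
    and op_right_unit:
      "\<lbrakk>x \<in> hom C U X; y \<in> hom C U X; x ;; \<beta> = y ;; \<beta>\<rbrakk> \<Longrightarrow>
       pregroupoid_op C M m1 m2 m3 \<mu> x y y = x"
    and op_left_unit:
      "\<lbrakk>x \<in> hom C U X; y \<in> hom C U X; x ;; \<alpha> = y ;; \<alpha>\<rbrakk> \<Longrightarrow>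
       pregroupoid_op C M m1 m2 m3 \<mu> x x y = y"
    and op_left_assoc:
      "\<lbrakk>x \<in> hom C U X; y \<in> hom C U X; z \<in> hom C U X; w \<in> hom C U X;
        x ;; \<beta> = y ;; \<beta>; y ;; \<beta> = z ;; \<beta>; z ;; \<alpha> = w ;; \<alpha>\<rbrakk> \<Longrightarrow>
       pregroupoid_op C M m1 m2 m3 \<mu> x y (pregroupoid_op C M m1 m2 m3 \<mu> y z w) =
       pregroupoid_op C M m1 m2 m3 \<mu> x z w"
    and op_right_assoc:
      "\<lbrakk>x \<in> hom C U X; y \<in> hom C U X; z \<in> hom C U X; w \<in> hom C U X;
        x ;; \<beta> = y ;; \<beta>; y ;; \<alpha> = z ;; \<alpha>; z ;; \<alpha> = w ;; \<alpha>\<rbrakk> \<Longrightarrow>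
       pregroupoid_op C M m1 m2 m3 \<mu> (pregroupoid_op C M m1 m2 m3 \<mu> x y z) z w =
       pregroupoid_op C M m1 m2 m3 \<mu> x y w"

end

theory Submission
  imports Defs
begin

text \<open>The map \<open>e\<close> picks a point in each nonempty fibre of \<open>\<beta>\<close>, as the identity map of a groupoid
  does, and the theorem is the analogue of the familiar trivialisation of the vertical tangent bundle of a Lie groupoid by
  translation. Given a point \<open>x\<close>, put \<open>y = e(\<beta>(x))\<close>, so that \<open>\<beta>(y) = \<beta>(x)\<close>. A tangent vector
  \<open>v\<close> at \<open>y\<close> along the fibre of \<open>\<alpha>\<close> is carried to \<open>0\<^sub>x \<circ> v\<close> (with lower index \<open>0\<^sub>y\<close>), computed with
  \<open>T\<mu>\<close>; this is a vector at \<open>x \<circ>\<^sub>y y = x\<close>, again along the fibre of \<open>\<alpha>\<close>. Conversely a vector \<open>w\<close>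
  along \<open>\<alpha>\<close> at \<open>x\<close> gives \<open>x\<close> together with \<open>0\<^sub>y \<circ> w\<close> (with lower index \<open>0\<^sub>x\<close>), a vector at \<open>y\<close>.
  Both are instances of one operation, \<open>transport\<close>, with the two points exchanged.

  That the two maps are mutually inverse is the law \<open>y \<circ>\<^sub>x (x \<circ>\<^sub>y z) = z\<close> for generalised elements of
  \<open>TX\<close>. The axioms only give it for elements of \<open>X\<close>, and \<open>TX\<close> has many generalised elements that are not
  images under \<open>T\<close>. The law is therefore read as an equation between arrows out of the triple fibre product
  \<open>M\<close>, to which \<open>T\<close> is applied; as \<open>T\<close> preserves \<open>M\<close>, the image equation is the law for
  \<open>TX\<close> (lemma \<open>T_heap_cancel\<close>). The base point of the result comes from naturality of \<open>p\<close> at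
  \<open>\<mu>\<close> (lemma \<open>T_heap_natural\<close>).

  To pass from elements to arrows, the maps are defined at the universal elements and compared after
  projecting: an arrow into \<open>T\<^sup>\<alpha>X\<close> is determined by the vector it names, an arrow into the fibre product
  by a point and a vector (lemmas \<open>TaX_eqI\<close> and \<open>XTaBX_eqI\<close>). Naturality of transport in
  the domain of the elements then evaluates both composites.\<close>

section \<open>Ternary operations on generalised elements\<close>

context category
begin

lemma triple_pullback_typing:
  assumes "is_triple_pullback C \<alpha> \<beta> M m1 m2 m3" "\<alpha> \<in> hom C X A"
  shows "m1 \<in> hom C M X" "m2 \<in> hom C M X" "m3 \<in> hom C M X"
  using assms by (auto simp: is_triple_pullback_def hom_def)

lemma triple_pullback_ex1:
  assumes "is_triple_pullback C \<alpha> \<beta> M m1 m2 m3" "\<alpha> \<in> hom C X A"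
    and "x \<in> hom C U X" "y \<in> hom C U X" "z \<in> hom C U X" "x ;; \<beta> = y ;; \<beta>" "y ;; \<alpha> = z ;; \<alpha>"
  shows "\<exists>!u. u \<in> hom C U M \<and> u ;; m1 = x \<and> u ;; m2 = y \<and> u ;; m3 = z"
proof -
  have "Dom C \<alpha> = X" using assms(2) by (simp add: hom_def)
  then show ?thesis using assms unfolding is_triple_pullback_def by blast
qed

lemma pregroupoid_op_lift:
  assumes "is_triple_pullback C \<alpha> \<beta> M m1 m2 m3" "\<alpha> \<in> hom C X A"
    and "x \<in> hom C U X" "y \<in> hom C U X" "z \<in> hom C U X" "x ;; \<beta> = y ;; \<beta>" "y ;; \<alpha> = z ;; \<alpha>"
  obtains u where "u \<in> hom C U M" "u ;; m1 = x" "u ;; m2 = y" "u ;; m3 = z"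
    "pregroupoid_op C M m1 m2 m3 \<mu> x y z = u ;; \<mu>"
proof -
  have U: "Dom C x = U" using assms(3) by (simp add: hom_def)
  show ?thesis
    using that theI'[OF triple_pullback_ex1[OF assms]] unfolding pregroupoid_op_def U by blast
qed

lemma pregroupoid_op_eq:
  assumes tp: "is_triple_pullback C \<alpha> \<beta> M m1 m2 m3" and a: "\<alpha> \<in> hom C X A" and b: "\<beta> \<in> hom C X B"
    and u: "u \<in> hom C U M" "u ;; m1 = x" "u ;; m2 = y" "u ;; m3 = z"
  shows "pregroupoid_op C M m1 m2 m3 \<mu> x y z = u ;; \<mu>"
proof -
  note m = triple_pullback_typing[OF tp a]
  have eqs: "m1 ;; \<beta> = m2 ;; \<beta>" "m2 ;; \<alpha> = m3 ;; \<alpha>"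
    using tp by (auto simp: is_triple_pullback_def)
  have xyz: "x \<in> hom C U X" "y \<in> hom C U X" "z \<in> hom C U X"
    using u m Comp_hom by blast+
  have "x ;; \<beta> = y ;; \<beta>" "y ;; \<alpha> = z ;; \<alpha>"
    using eqs Comp_assoc[OF u(1) m(1) b] Comp_assoc[OF u(1) m(2) b]
      Comp_assoc[OF u(1) m(2) a] Comp_assoc[OF u(1) m(3) a] u by auto
  note ex1 = triple_pullback_ex1[OF tp a xyz this]
  have U: "Dom C x = U" using xyz(1) by (simp add: hom_def)
  show ?thesis
    unfolding pregroupoid_op_def U using the1_equality[OF ex1] u by auto
qed

text \<open>The lift of a precomposed triple is the precomposed lift. This is what makes the
  operation on generalised elements natural in their common domain, so that a calculation with
  elements yields an identity of arrows.\<close>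

lemma comp_pregroupoid_op:
  assumes tp: "is_triple_pullback C \<alpha> \<beta> M m1 m2 m3" and a: "\<alpha> \<in> hom C X A" and b: "\<beta> \<in> hom C X B"
    and mu: "\<mu> \<in> hom C M X"
    and xyz: "x \<in> hom C U X" "y \<in> hom C U X" "z \<in> hom C U X" "x ;; \<beta> = y ;; \<beta>" "y ;; \<alpha> = z ;; \<alpha>"
    and s: "s \<in> hom C V U"
  shows "s ;; pregroupoid_op C M m1 m2 m3 \<mu> x y z =
    pregroupoid_op C M m1 m2 m3 \<mu> (s ;; x) (s ;; y) (s ;; z)"
proof -
  obtain u where u: "u \<in> hom C U M" "u ;; m1 = x" "u ;; m2 = y" "u ;; m3 = z"
    "pregroupoid_op C M m1 m2 m3 \<mu> x y z = u ;; \<mu>"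
    using pregroupoid_op_lift[OF tp a xyz] by metis
  note m = triple_pullback_typing[OF tp a]
  have su: "s ;; u \<in> hom C V M" by (rule Comp_hom[OF s u(1)])
  have "pregroupoid_op C M m1 m2 m3 \<mu> (s ;; x) (s ;; y) (s ;; z) = (s ;; u) ;; \<mu>"
    using Comp_assoc[OF s u(1)] m u(2-4) by (intro pregroupoid_op_eq[OF tp a b su]) auto
  then show ?thesis using Comp_assoc[OF s u(1) mu] u(5) by simp
qed

end

section \<open>Cancellation in a pregroupoid\<close>

context pregroupoid
begin

abbreviation heap :: "'m \<Rightarrow> 'm \<Rightarrow> 'm \<Rightarrow> 'm" where
  "heap x y z \<equiv> pregroupoid_op C M m1 m2 m3 \<mu> x y z"

lemmas proj_hom = triple_pullback_typing[OF triple_pullback alpha_hom]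

lemma proj_eqs: "m1 ;; \<beta> = m2 ;; \<beta>" "m2 ;; \<alpha> = m3 ;; \<alpha>"
  using triple_pullback by (auto simp: is_triple_pullback_def)

lemma heap_proj: "heap m1 m2 m3 = \<mu>"
proof -
  have id: "Ident C M \<in> hom C M M"
    using mu_hom Dom_Obj Ident_hom by (auto simp: hom_def)
  show ?thesis
    using pregroupoid_op_eq[OF triple_pullback alpha_hom beta_hom id] proj_hom mu_hom Ident_Comp by metis
qed

lemma mu_alpha: "\<mu> ;; \<alpha> = m1 ;; \<alpha>"
  using alpha_op[OF proj_hom proj_eqs] heap_proj by simp

text \<open>By left associativity \<open>y \<circ>\<^sub>x (x \<circ>\<^sub>y z) = y \<circ>\<^sub>y z\<close>, and this is \<open>z\<close>. The special case is
  singled out because it lives on the triple fibre product itself, whereas general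
  associativity lives on a fourfold one, about whose existence and preservation nothing is
  assumed.\<close>

lemma heap_cancel:
  assumes x: "x \<in> hom C U X" and y: "y \<in> hom C U X" and z: "z \<in> hom C U X"
    and xy: "x ;; \<beta> = y ;; \<beta>" and yz: "y ;; \<alpha> = z ;; \<alpha>"
  shows "heap y x (heap x y z) = z"
  using op_left_assoc[OF y x y z xy[symmetric] xy yz] op_left_unit[OF y z yz] by simp

end

section \<open>The image of a pregroupoid under a functor\<close>

locale preserved_pregroupoid = pregroupoid C A X B \<alpha> \<beta> M m1 m2 m3 \<mu> + T: category_functor C C T
  for C :: "('o, 'm, 'z) precategory_scheme" (structure)
    and A X B :: 'o and \<alpha> \<beta> :: 'm and M :: 'o and m1 m2 m3 \<mu> :: 'm
    and T :: "('o, 'm, 'o, 'm) prefunctor" +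
  assumes preserved: "preserves_triple_pullback C T \<alpha> \<beta> M m1 m2 m3"
begin

abbreviation T_heap :: "'m \<Rightarrow> 'm \<Rightarrow> 'm \<Rightarrow> 'm" where
  "T_heap x y z \<equiv>
    pregroupoid_op C (omap T M) (amap T m1) (amap T m2) (amap T m3) (amap T \<mu>) x y z"

lemmas T_triple_pullback = preserved[unfolded preserves_triple_pullback_def]

lemmas T_alpha = T.amap_hom[OF alpha_hom]

lemmas T_beta = T.amap_hom[OF beta_hom]

lemmas T_mu = T.amap_hom[OF mu_hom]

lemmas T_heap_lift = pregroupoid_op_lift[OF T_triple_pullback T_alpha]

lemmas T_heap_eq = pregroupoid_op_eq[OF T_triple_pullback T_alpha T_beta]

lemmas comp_T_heap = comp_pregroupoid_op[OF T_triple_pullback T_alpha T_beta T_mu]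

context
  fixes x y z :: 'm and U :: 'o
  assumes x: "x \<in> hom C U (omap T X)" and y: "y \<in> hom C U (omap T X)"
    and z: "z \<in> hom C U (omap T X)"
    and xy: "x ;; amap T \<beta> = y ;; amap T \<beta>" and yz: "y ;; amap T \<alpha> = z ;; amap T \<alpha>"
begin

lemma T_heap_hom: "T_heap x y z \<in> hom C U (omap T X)"
  using T_heap_lift[OF x y z xy yz, of "amap T \<mu>"] Comp_hom[OF _ T_mu] by metis

lemma T_heap_alpha: "T_heap x y z ;; amap T \<alpha> = x ;; amap T \<alpha>"
proof -
  obtain u where u: "u \<in> hom C U (omap T M)" "u ;; amap T m1 = x" "T_heap x y z = u ;; amap T \<mu>"
    using T_heap_lift[OF x y z xy yz] by metis
  have "amap T \<mu> ;; amap T \<alpha> = amap T m1 ;; amap T \<alpha>"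
    using T.amap_Comp[OF mu_hom alpha_hom] T.amap_Comp[OF proj_hom(1) alpha_hom] mu_alpha by simp
  then show ?thesis
    using u Comp_assoc[OF u(1) T_mu T_alpha] Comp_assoc[OF u(1) T.amap_hom[OF proj_hom(1)] T_alpha]
    by simp
qed

text \<open>The cancellation law at the universal triple says that a certain endomorphism of the
  fibre product, followed by \<open>\<mu>\<close>, is a projection. Any functor respects such an equation, and
  since it preserves the fibre product the equation again expresses the law for generalised
  elements.\<close>

lemma T_heap_cancel: "T_heap y x (T_heap x y z) = z"
proof -
  obtain u where u: "u \<in> hom C U (omap T M)" "u ;; amap T m1 = x" "u ;; amap T m2 = y"
    "u ;; amap T m3 = z" "T_heap x y z = u ;; amap T \<mu>"
    using T_heap_lift[OF x y z xy yz] by metis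
  \<comment> \<open>\<open>n\<close> sends \<open>(x, y, z)\<close> to \<open>(y, x, x \<circ>\<^sub>y z)\<close>.\<close>
  obtain n where n: "n \<in> hom C M M" "n ;; m1 = m2" "n ;; m2 = m1" "n ;; m3 = \<mu>"
    and "heap m2 m1 \<mu> = n ;; \<mu>"
    using pregroupoid_op_lift[OF triple_pullback alpha_hom proj_hom(2,1) mu_hom
        proj_eqs(1)[symmetric] mu_alpha[symmetric]] by metis
  then have "n ;; \<mu> = m3"
    using heap_cancel[OF proj_hom proj_eqs] heap_proj by simp
  then have Tn: "amap T n ;; amap T m1 = amap T m2" "amap T n ;; amap T m2 = amap T m1"
    "amap T n ;; amap T m3 = amap T \<mu>" "amap T n ;; amap T \<mu> = amap T m3"
    using T.amap_Comp[OF n(1)] proj_hom mu_hom n by metis+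
  have Tn_hom: "amap T n \<in> hom C (omap T M) (omap T M)" by (rule T.amap_hom[OF n(1)])
  have assoc: "(u ;; amap T n) ;; amap T h = u ;; (amap T n ;; amap T h)" if "h \<in> hom C M X" for h
    by (rule Comp_assoc[OF u(1) Tn_hom T.amap_hom[OF that]])
  have "T_heap y x (u ;; amap T \<mu>) = (u ;; amap T n) ;; amap T \<mu>"
    using assoc proj_hom Tn u by (intro T_heap_eq[OF Comp_hom[OF u(1) Tn_hom]]) auto
  then show ?thesis
    using assoc[OF mu_hom] Tn u by simp
qed

text \<open>This is naturality at \<open>\<mu>\<close>; naturality at the three projections identifies the triple that
  it produces.\<close>

lemma T_heap_natural:
  assumes "natural_transformation C C T id_functor p"
  shows "T_heap x y z ;; p X = heap (x ;; p X) (y ;; p X) (z ;; p X)"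
proof -
  interpret p: natural_transformation C C T id_functor p by fact
  have Obj: "M \<in> Obj C" "X \<in> Obj C"
    using Dom_Obj Cod_Obj mu_hom by (auto simp: hom_def)
  have pM: "p M \<in> hom C (omap T M) M" and pX: "p X \<in> hom C (omap T X) X"
    using p.component_hom Obj by (auto simp: id_functor_def)
  obtain u where u: "u \<in> hom C U (omap T M)" "u ;; amap T m1 = x" "u ;; amap T m2 = y"
    "u ;; amap T m3 = z" "T_heap x y z = u ;; amap T \<mu>"
    using T_heap_lift[OF x y z xy yz] by metis
  have nat: "(u ;; p M) ;; h = (u ;; amap T h) ;; p X" if h: "h \<in> hom C M X" for h
    using p.naturality[OF h] Comp_assoc[OF u(1) pM h] Comp_assoc[OF u(1) T.amap_hom[OF h] pX]
    by (simp add: id_functor_def)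
  have "heap (x ;; p X) (y ;; p X) (z ;; p X) = (u ;; p M) ;; \<mu>"
    using nat proj_hom u
    by (intro pregroupoid_op_eq[OF triple_pullback alpha_hom beta_hom Comp_hom[OF u(1) pM]]) auto
  then show ?thesis using nat[OF mu_hom] u(5) by simp
qed

end

end

section \<open>Transport of vertical tangent vectors\<close>

locale tangent_pregroupoid = preserved_pregroupoid C A X B \<alpha> \<beta> M m1 m2 m3 \<mu> T +
    p: natural_transformation C C T id_functor p + Z: natural_transformation C C id_functor T zero
  for C :: "('o, 'm, 'z) precategory_scheme" (structure)
    and A X B :: 'o and \<alpha> \<beta> :: 'm and M :: 'o and m1 m2 m3 \<mu> :: 'm
    and T :: "('o, 'm, 'o, 'm) prefunctor" and p zero :: "'o \<Rightarrow> 'm" +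
  assumes zero_section: "Y \<in> Obj C \<Longrightarrow> zero Y ;; p Y = Ident C Y"
begin

lemma Obj: "A \<in> Obj C" "X \<in> Obj C" "B \<in> Obj C"
  using Dom_Obj Cod_Obj alpha_hom beta_hom by (auto simp: hom_def)

lemma p_hom: "p X \<in> hom C (omap T X) X"
  using p.component_hom Obj by (simp add: id_functor_def)

lemma zero_hom: "Y \<in> Obj C \<Longrightarrow> zero Y \<in> hom C Y (omap T Y)"
  using Z.component_hom by (simp add: id_functor_def)

lemma p_alpha: "amap T \<alpha> ;; p A = p X ;; \<alpha>"
  using p.naturality[OF alpha_hom] by (simp add: id_functor_def)

lemma zero_vector_hom: "x \<in> hom C U X \<Longrightarrow> x ;; zero X \<in> hom C U (omap T X)"
  using Comp_hom zero_hom Obj by blast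

lemma zero_vector_image:
  assumes x: "x \<in> hom C U X" and f: "f \<in> hom C X Y"
  shows "(x ;; zero X) ;; amap T f = (x ;; f) ;; zero Y"
proof -
  have Y: "Y \<in> Obj C" using f Cod_Obj by (auto simp: hom_def)
  have "zero X ;; amap T f = f ;; zero Y"
    using Z.naturality[OF f] by (simp add: id_functor_def)
  then show ?thesis
    using Comp_assoc[OF x zero_hom[OF Obj(2)] T.amap_hom[OF f]] Comp_assoc[OF x f zero_hom[OF Y]]
    by simp
qed

lemma zero_vector_base: "x \<in> hom C U X \<Longrightarrow> (x ;; zero X) ;; p X = x"
  using Comp_assoc[OF _ zero_hom[OF Obj(2)] p_hom] zero_section[OF Obj(2)] Comp_Ident by metis

text \<open>Generalised elements of \<open>T\<^sup>\<alpha>X\<close> over the point \<open>x\<close>, described without the object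
  \<open>T\<^sup>\<alpha>X\<close>: tangent vectors at \<open>x\<close> along the fibres of \<open>\<alpha>\<close>.\<close>

definition vertical :: "'o \<Rightarrow> 'm \<Rightarrow> 'm \<Rightarrow> bool" where
  "vertical U x v \<longleftrightarrow>
    v \<in> hom C U (omap T X) \<and> v ;; p X = x \<and> v ;; amap T \<alpha> = (x ;; \<alpha>) ;; zero A"

definition transport :: "'m \<Rightarrow> 'm \<Rightarrow> 'm \<Rightarrow> 'm" where
  "transport x y v = T_heap (x ;; zero X) (y ;; zero X) v"

context
  fixes x y v :: 'm and U :: 'o
  assumes x: "x \<in> hom C U X" and y: "y \<in> hom C U X" and xy: "x ;; \<beta> = y ;; \<beta>"
    and v: "vertical U y v"
begin

lemma transport_composable:
  "x ;; zero X \<in> hom C U (omap T X)" "y ;; zero X \<in> hom C U (omap T X)"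
  "v \<in> hom C U (omap T X)"
  "(x ;; zero X) ;; amap T \<beta> = (y ;; zero X) ;; amap T \<beta>"
  "(y ;; zero X) ;; amap T \<alpha> = v ;; amap T \<alpha>"
  using x y xy v zero_vector_hom zero_vector_image[OF _ beta_hom] zero_vector_image[OF _ alpha_hom]
  by (auto simp: vertical_def)

text \<open>Fibrewise, \<open>x \<circ>\<^sub>y _\<close> maps the \<open>\<alpha>\<close>-fibre of \<open>y\<close> to that of \<open>x\<close> and takes \<open>y\<close> to
  \<open>x\<close>; transport is its derivative at \<open>y\<close>.\<close>

lemma transport_vertical: "vertical U x (transport x y v)"
proof -
  have "transport x y v ;; p X = heap x y y"
    using T_heap_natural[OF transport_composable p.natural_transformation_axioms] v
      zero_vector_base x y by (simp add: transport_def vertical_def)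
  also have "\<dots> = x" by (rule op_right_unit[OF x y xy])
  finally show ?thesis
    using T_heap_hom[OF transport_composable] T_heap_alpha[OF transport_composable]
      zero_vector_image[OF x alpha_hom]
    by (simp add: vertical_def transport_def)
qed

lemma transport_cancel: "transport y x (transport x y v) = v"
  unfolding transport_def by (rule T_heap_cancel[OF transport_composable])

lemma comp_transport:
  assumes s: "s \<in> hom C V U"
  shows "s ;; transport x y v = transport (s ;; x) (s ;; y) (s ;; v)"
  unfolding transport_def
  using comp_T_heap[OF transport_composable s] Comp_assoc[OF s _ zero_hom[OF Obj(2)]] x y by simp

end

end

section \<open>Trivialisation of the vertical tangent bundle\<close>

locale tangent_pullbacks = tangent_pregroupoid C A X B \<alpha> \<beta> M m1 m2 m3 \<mu> T p zero
  for C :: "('o, 'm, 'z) precategory_scheme" (structure)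
    and A X B :: 'o and \<alpha> \<beta> :: 'm and M :: 'o and m1 m2 m3 \<mu> :: 'm
    and T :: "('o, 'm, 'o, 'm) prefunctor" and p zero :: "'o \<Rightarrow> 'm" +
  fixes TaX TaBX XTaBX :: 'o and e \<iota> \<pi> \<iota>B \<pi>B pr1 pr2 :: 'm
  assumes e_hom: "e \<in> hom C B X"
    and beta_e_beta: "\<beta> ;; e ;; \<beta> = \<beta>"
    and TaX: "is_pullback C (amap T \<alpha>) (zero A) TaX \<iota> \<pi>"
    and TaBX: "is_pullback C (\<iota> ;; p X) e TaBX \<iota>B \<pi>B"
    and XTaBX: "is_pullback C \<beta> \<pi>B XTaBX pr1 pr2"
begin

lemma typing:
  "\<iota> \<in> hom C TaX (omap T X)" "\<pi> \<in> hom C TaX A" "\<iota> ;; p X \<in> hom C TaX X"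
  "\<iota>B \<in> hom C TaBX TaX" "\<pi>B \<in> hom C TaBX B"
  "pr1 \<in> hom C XTaBX X" "pr2 \<in> hom C XTaBX TaBX"
proof -
  show i: "\<iota> \<in> hom C TaX (omap T X)" "\<pi> \<in> hom C TaX A"
    using TaX T_alpha zero_hom[OF Obj(1)] by (auto simp: is_pullback_def hom_def)
  show ip: "\<iota> ;; p X \<in> hom C TaX X" by (rule Comp_hom[OF i(1) p_hom])
  show b: "\<iota>B \<in> hom C TaBX TaX" "\<pi>B \<in> hom C TaBX B"
    using TaBX ip e_hom by (auto simp: is_pullback_def hom_def)
  show "pr1 \<in> hom C XTaBX X" "pr2 \<in> hom C XTaBX TaBX"
    using XTaBX beta_hom b by (auto simp: is_pullback_def hom_def)
qed

lemma squares: "\<iota> ;; amap T \<alpha> = \<pi> ;; zero A" "\<iota>B ;; (\<iota> ;; p X) = \<pi>B ;; e" "pr1 ;; \<beta> = pr2 ;; \<pi>B"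
  using TaX TaBX XTaBX by (auto simp: is_pullback_def)

text \<open>As \<open>0\<close> is a section of \<open>p\<close>, the second projection of \<open>T\<^sup>\<alpha>X\<close> is determined by the first.\<close>

lemma pi_eq: "\<pi> = (\<iota> ;; p X) ;; \<alpha>"
proof -
  have pA: "p A \<in> hom C (omap T A) A"
    using p.component_hom Obj by (simp add: id_functor_def)
  have "\<pi> = \<pi> ;; (zero A ;; p A)" using zero_section[OF Obj(1)] Comp_Ident typing by simp
  also have "\<dots> = (\<iota> ;; amap T \<alpha>) ;; p A"
    using Comp_assoc[OF typing(2) zero_hom[OF Obj(1)] pA] squares(1) by simp
  also have "\<dots> = (\<iota> ;; p X) ;; \<alpha>"
    using Comp_assoc[OF typing(1) T_alpha pA] Comp_assoc[OF typing(1) p_hom alpha_hom] p_alpha by simp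
  finally show ?thesis .
qed

lemma vertical_iota: "vertical TaX (\<iota> ;; p X) \<iota>"
  using typing(1) squares(1) pi_eq by (simp add: vertical_def)

lemma vertical_comp:
  assumes v: "vertical U x v" and x: "x \<in> hom C U X" and s: "s \<in> hom C V U"
  shows "vertical V (s ;; x) (s ;; v)"
proof -
  have vh: "v \<in> hom C U (omap T X)" using v by (simp add: vertical_def)
  have "s ;; ((x ;; \<alpha>) ;; zero A) = ((s ;; x) ;; \<alpha>) ;; zero A"
    using Comp_assoc[OF s Comp_hom[OF x alpha_hom] zero_hom[OF Obj(1)]]
      Comp_assoc[OF s x alpha_hom] by simp
  then show ?thesis
    using v Comp_hom[OF s vh] Comp_assoc[OF s vh p_hom] Comp_assoc[OF s vh T_alpha]
    by (simp add: vertical_def)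
qed

lemma TaX_lift:
  assumes x: "x \<in> hom C U X" and v: "vertical U x v"
  obtains t where "t \<in> hom C U TaX" "t ;; \<iota> = v"
  using is_pullback_ex1[OF TaX T_alpha zero_hom[OF Obj(1)] _ Comp_hom[OF x alpha_hom], of v] v
  by (auto simp: vertical_def)

lemma TaX_eqI:
  assumes "s \<in> hom C U TaX" "t \<in> hom C U TaX" "s ;; \<iota> = t ;; \<iota>"
  shows "s = t"
proof -
  have "s ;; ((\<iota> ;; p X) ;; \<alpha>) = t ;; ((\<iota> ;; p X) ;; \<alpha>)"
    using assms Comp_assoc[OF _ typing(1) Comp_hom[OF p_hom alpha_hom]] Comp_assoc[OF typing(1) p_hom alpha_hom]
    by metis
  then have "s ;; \<pi> = t ;; \<pi>" using pi_eq by simp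
  moreover have "(s ;; \<iota>) ;; amap T \<alpha> = (s ;; \<pi>) ;; zero A"
    using assms(1) squares(1) Comp_assoc[OF _ typing(1) T_alpha] Comp_assoc[OF _ typing(2) zero_hom[OF Obj(1)]]
    by metis
  moreover have "s ;; \<iota> \<in> hom C U (omap T X)" "s ;; \<pi> \<in> hom C U A"
    using assms(1) typing Comp_hom by blast+
  ultimately show ?thesis
    using is_pullback_ex1[OF TaX T_alpha zero_hom[OF Obj(1)]] assms by metis
qed

text \<open>The tangent vector in the universal pair consisting of a point \<open>x\<close> and a vertical vector at
  \<open>e(\<beta>(x))\<close>; the point is \<open>pr1\<close>.\<close>

definition vec :: 'm where "vec = pr2 ;; (\<iota>B ;; \<iota>)"

text \<open>In the pregroupoid of a groupoid with \<open>e\<close> its identity map, this is the identity arrow at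
  the endpoint \<open>\<beta>(x)\<close> of the arrow \<open>x\<close>.\<close>

definition unit_at :: "'m \<Rightarrow> 'm" where "unit_at x = (x ;; \<beta>) ;; e"

lemma unit_at_hom: "x \<in> hom C U X \<Longrightarrow> unit_at x \<in> hom C U X"
  using Comp_hom beta_hom e_hom unfolding unit_at_def by blast

lemma unit_at_beta: "x \<in> hom C U X \<Longrightarrow> unit_at x ;; \<beta> = x ;; \<beta>"
  unfolding unit_at_def
  using Comp_assoc[OF _ beta_hom e_hom] Comp_assoc[OF _ Comp_hom[OF beta_hom e_hom] beta_hom]
    beta_e_beta by metis

lemma comp_unit_at: "s \<in> hom C V U \<Longrightarrow> x \<in> hom C U X \<Longrightarrow> s ;; unit_at x = unit_at (s ;; x)"
  unfolding unit_at_def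
  using Comp_assoc[OF _ _ beta_hom, of s V U x] Comp_assoc[OF _ _ e_hom, of s V U "x ;; \<beta>"]
    Comp_hom[OF _ beta_hom, of x U] by simp

lemma vec_hom: "vec \<in> hom C XTaBX (omap T X)"
  unfolding vec_def using typing Comp_hom by blast

lemma vec_base: "vec ;; p X = unit_at pr1"
proof -
  have "vec ;; p X = pr2 ;; (\<iota>B ;; (\<iota> ;; p X))"
    unfolding vec_def using Comp_assoc[OF typing(7) Comp_hom[OF typing(4,1)] p_hom]
      Comp_assoc[OF typing(4,1) p_hom] by simp
  also have "\<dots> = (pr1 ;; \<beta>) ;; e"
    using squares(2,3) Comp_assoc[OF typing(7,5) e_hom] by simp
  finally show ?thesis by (simp add: unit_at_def)
qed

lemma vertical_vec: "vertical XTaBX (unit_at pr1) vec"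
proof -
  have h: "pr2 ;; \<iota>B \<in> hom C XTaBX TaX" using typing Comp_hom by blast
  have v: "(pr2 ;; \<iota>B) ;; \<iota> = vec"
    unfolding vec_def by (rule Comp_assoc[OF typing(7,4,1)])
  have "(pr2 ;; \<iota>B) ;; (\<iota> ;; p X) = unit_at pr1"
    using Comp_assoc[OF h typing(1) p_hom] v vec_base by simp
  then show ?thesis
    using vertical_comp[OF vertical_iota typing(3) h] v by simp
qed

lemma XTaBX_lift:
  assumes x: "x \<in> hom C U X" and v: "vertical U (unit_at x) v"
  obtains s where "s \<in> hom C U XTaBX" "s ;; pr1 = x" "s ;; vec = v"
proof -
  obtain t where t: "t \<in> hom C U TaX" "t ;; \<iota> = v"
    using TaX_lift[OF unit_at_hom[OF x] v] .
  have "t ;; (\<iota> ;; p X) = (x ;; \<beta>) ;; e"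
    using Comp_assoc[OF t(1) typing(1) p_hom] t v by (simp add: vertical_def unit_at_def)
  then obtain r where r: "r \<in> hom C U TaBX" "r ;; \<iota>B = t" "r ;; \<pi>B = x ;; \<beta>"
    using is_pullback_ex1[OF TaBX typing(3) e_hom t(1) Comp_hom[OF x beta_hom]] by blast
  obtain s where s: "s \<in> hom C U XTaBX" "s ;; pr1 = x" "s ;; pr2 = r"
    using is_pullback_ex1[OF XTaBX beta_hom typing(5) x r(1) r(3)[symmetric]] by blast
  have "s ;; vec = v"
    unfolding vec_def using Comp_assoc[OF s(1) typing(7) Comp_hom[OF typing(4,1)]]
      Comp_assoc[OF r(1) typing(4,1)] s r t by simp
  then show ?thesis using that s by blast
qed

text \<open>An element consists of \<open>x\<close>, a vector \<open>v\<close> and some \<open>b\<close> with \<open>e(b)\<close> the base point of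
  \<open>v\<close>. Since \<open>e\<close> may fail to be monic, \<open>v\<close> does not determine \<open>b\<close>; but \<open>b = \<beta>(x)\<close>.\<close>

lemma XTaBX_eqI:
  assumes s: "s \<in> hom C U XTaBX" and t: "t \<in> hom C U XTaBX"
    and 1: "s ;; pr1 = t ;; pr1" and 2: "s ;; vec = t ;; vec"
  shows "s = t"
proof -
  have h: "r ;; pr1 \<in> hom C U X" "r ;; pr2 \<in> hom C U TaBX" "(r ;; pr2) ;; \<iota>B \<in> hom C U TaX"
    "(r ;; pr2) ;; \<pi>B = (r ;; pr1) ;; \<beta>" "((r ;; pr2) ;; \<iota>B) ;; \<iota> = r ;; vec"
    "((r ;; pr2) ;; \<iota>B) ;; (\<iota> ;; p X) = ((r ;; pr2) ;; \<pi>B) ;; e"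
    if r: "r \<in> hom C U XTaBX" for r
  proof -
    show r1: "r ;; pr1 \<in> hom C U X" and r2: "r ;; pr2 \<in> hom C U TaBX"
      and r3: "(r ;; pr2) ;; \<iota>B \<in> hom C U TaX"
      using r typing Comp_hom by blast+
    show "(r ;; pr2) ;; \<pi>B = (r ;; pr1) ;; \<beta>"
      using Comp_assoc[OF r typing(7,5)] Comp_assoc[OF r typing(6) beta_hom] squares(3) by simp
    show "((r ;; pr2) ;; \<iota>B) ;; \<iota> = r ;; vec"
      using Comp_assoc[OF r typing(7) Comp_hom[OF typing(4,1)]] Comp_assoc[OF r2 typing(4,1)]
      by (simp add: vec_def)
    show "((r ;; pr2) ;; \<iota>B) ;; (\<iota> ;; p X) = ((r ;; pr2) ;; \<pi>B) ;; e"
      using Comp_assoc[OF r2 typing(4,3)] Comp_assoc[OF r2 typing(5) e_hom] squares(2) by simp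
  qed
  have "(s ;; pr2) ;; \<iota>B = (t ;; pr2) ;; \<iota>B"
    using TaX_eqI h(3,5)[OF s] h(3,5)[OF t] 2 by simp
  moreover have "(s ;; pr2) ;; \<pi>B = (t ;; pr2) ;; \<pi>B"
    using h(4)[OF s] h(4)[OF t] 1 by simp
  ultimately have "s ;; pr2 = t ;; pr2"
    using is_pullback_ex1[OF TaBX typing(3) e_hom h(3)[OF s] Comp_hom[OF h(2)[OF s] typing(5)] h(6)[OF s]]
      h(2)[OF s] h(2)[OF t] by metis
  then show ?thesis
    using is_pullback_ex1[OF XTaBX beta_hom typing(5) h(1)[OF s] h(2)[OF s] h(4)[OF s, symmetric]]
      s t 1 by metis
qed

lemma isomorphic_XTaBX_TaX: "isomorphic C XTaBX TaX"
proof -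
  note x = typing(6) and y = unit_at_hom[OF typing(6)]
  let ?x = "\<iota> ;; p X"
  note u = unit_at_hom[OF typing(3)]
  have xy: "pr1 ;; \<beta> = unit_at pr1 ;; \<beta>" using unit_at_beta[OF x] by simp
  have xu: "unit_at ?x ;; \<beta> = ?x ;; \<beta>" by (rule unit_at_beta[OF typing(3)])
  note t = transport_vertical[OF x y xy vertical_vec]
  note w = transport_vertical[OF u typing(3) xu vertical_iota]
  obtain f where f: "f \<in> hom C XTaBX TaX" "f ;; \<iota> = transport pr1 (unit_at pr1) vec"
    using TaX_lift[OF x t] .
  obtain g where g: "g \<in> hom C TaX XTaBX" "g ;; pr1 = ?x" "g ;; vec = transport (unit_at ?x) ?x \<iota>"
    using XTaBX_lift[OF typing(3) w] .
  have f_base: "f ;; ?x = pr1"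
    using Comp_assoc[OF f(1) typing(1) p_hom] f(2) t by (simp add: vertical_def)
  have Obj': "XTaBX \<in> Obj C" "TaX \<in> Obj C"
    using Dom_Obj Cod_Obj f(1) by (auto simp: hom_def)
  have fg: "f ;; g = Ident C XTaBX"
  proof (rule XTaBX_eqI[OF Comp_hom[OF f(1) g(1)] Ident_hom[OF Obj'(1)]])
    show "(f ;; g) ;; pr1 = Ident C XTaBX ;; pr1"
      using Comp_assoc[OF f(1) g(1) x] g(2) f_base Ident_Comp[OF x] by simp
    have "(f ;; g) ;; vec = f ;; transport (unit_at ?x) ?x \<iota>"
      using Comp_assoc[OF f(1) g(1) vec_hom] g(3) by simp
    also have "\<dots> = transport (unit_at pr1) pr1 (transport pr1 (unit_at pr1) vec)"
      using comp_transport[OF u typing(3) xu vertical_iota f(1)] comp_unit_at[OF f(1) typing(3)]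
        f_base f(2) by simp
    also have "\<dots> = vec" by (rule transport_cancel[OF x y xy vertical_vec])
    finally show "(f ;; g) ;; vec = Ident C XTaBX ;; vec" using Ident_Comp[OF vec_hom] by simp
  qed
  have "g ;; f = Ident C TaX"
  proof (rule TaX_eqI[OF Comp_hom[OF g(1) f(1)] Ident_hom[OF Obj'(2)]])
    have "(g ;; f) ;; \<iota> = g ;; transport pr1 (unit_at pr1) vec"
      using Comp_assoc[OF g(1) f(1) typing(1)] f(2) by simp
    also have "\<dots> = transport ?x (unit_at ?x) (transport (unit_at ?x) ?x \<iota>)"
      using comp_transport[OF x y xy vertical_vec g(1)] comp_unit_at[OF g(1) x] g(2,3) by simp
    also have "\<dots> = \<iota>" by (rule transport_cancel[OF u typing(3) xu vertical_iota])
    finally show "(g ;; f) ;; \<iota> = Ident C TaX ;; \<iota>" using Ident_Comp[OF typing(1)] by simp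
  qed
  with fg f(1) g(1) Obj' show ?thesis unfolding isomorphic_def by blast
qed

end

theorem proposition4p11:
  fixes \<X> :: "('o, 'm) precategory" (structure)
    and T :: "('o, 'm, 'o, 'm) prefunctor"
    and p zero :: "'o \<Rightarrow> 'm"
    and A X B M TaX TaBX XTaBX :: 'o
    and \<alpha> \<beta> m1 m2 m3 \<mu> e \<iota> \<pi> \<iota>B \<pi>B pr1 pr2 :: 'm
  assumes "category \<X>"
    and "category_functor \<X> \<X> T"
    and "natural_transformation \<X> \<X> T id_functor p"
    and "natural_transformation \<X> \<X> id_functor T zero"
    and "\<And>Y. Y \<in> Obj \<X> \<Longrightarrow> zero Y ;; p Y = Ident \<X> Y"
    and "pregroupoid \<X> A X B \<alpha> \<beta> M m1 m2 m3 \<mu>"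
    and "preserves_triple_pullback \<X> T \<alpha> \<beta> M m1 m2 m3"
    and "e \<in> hom \<X> B X"
    and "\<beta> ;; e ;; \<beta> = \<beta>"
    and "is_pullback \<X> (amap T \<alpha>) (zero A) TaX \<iota> \<pi>"
    and "preserves_pullback \<X> T (amap T \<alpha>) (zero A) TaX \<iota> \<pi>"
    and "is_pullback \<X> (\<iota> ;; p X) e TaBX \<iota>B \<pi>B"
    and "preserves_pullback \<X> T (\<iota> ;; p X) e TaBX \<iota>B \<pi>B"
    and "is_pullback \<X> \<beta> \<pi>B XTaBX pr1 pr2"
    and "preserves_pullback \<X> T \<beta> \<pi>B XTaBX pr1 pr2"
  shows "isomorphic \<X> XTaBX TaX"
proof -
  interpret tangent_pullbacks \<X> A X B \<alpha> \<beta> M m1 m2 m3 \<mu> T p zero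
    TaX TaBX XTaBX e \<iota> \<pi> \<iota>B \<pi>B pr1 pr2
    using assms
    by (intro tangent_pullbacks.intro tangent_pregroupoid.intro preserved_pregroupoid.intro
        preserved_pregroupoid_axioms.intro tangent_pregroupoid_axioms.intro
        tangent_pullbacks_axioms.intro)
  show ?thesis by (rule isomorphic_XTaBX_TaX)
qed

end
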